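(* For every real $c>0$ the following holds for all sufficiently large perfect squares $n$. Let $p_1<p_2<\cdots$ be the primes congruent to $1$ modulo $4$ in increasing order, let $r$ be the largest integer such that $m:=p_1p_2\cdots p_{r-1}\le n/4$, and let $V\subset\mathbb{C}$ be the $\sqrt{n}\times\sqrt{n}$ square grid with step $1/\sqrt{m}$, i.e. $V=\{(a+ib)/\sqrt{m} : a,b\in\mathbb{Z},\ 0\le a,b<\sqrt{n}\}$. Then there is a subgroup $\Gamma\subset\mathbb{C}^*$ of rank at most $r-1$ such that $q-p\in\Gamma$ for all $p,q\in V$ with $|q-p|=1$; moreover $$r-1\le \frac{16\log n}{\log\log n}-1\le c\log n .$$
   Context: $\mathbb{C}^*$ denotes the multiplicative group of nonzero complex numbers. The set $V$ is Erdős' lower bound configuration of $n$ points for the unit distance problem in the plane (identified with $\mathbb{C}$). A subgroup $\Gamma\subset\mathbb{C}^*$ has rank $s$ if there exists a finitely generated subgroup $\Gamma_0\subset\Gamma$ with $s$ generators such that for every $x\in\Gamma$ there exists an integer $k\ge 1$ with $x^k\in\Gamma_0$. *)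

theory Defs
  imports
    Complex_Main
    "HOL-Algebra.Generated_Groups"
    "HOL-Computational_Algebra.Primes"
    "HOL-Computational_Algebra.Nth_Powers"
    "HOL-Library.Infinite_Set"
begin

definition Cstar :: "complex monoid" where
  "Cstar = \<lparr>carrier = - {0}, monoid.mult = (*), one = 1\<rparr>"

text \<open>
  The number \<open>s\<close> with this property is not unique (a system of generators may be redundant);
  the least such \<open>s\<close> is the usual rank. Bounding the rank from above by \<open>t\<close> means the same
  under both readings: the property holds for some \<open>s \<le> t\<close>.
\<close>

definition has_rank :: "complex set \<Rightarrow> nat \<Rightarrow> bool" where
  "has_rank \<Gamma> s \<longleftrightarrow> subgroup \<Gamma> Cstar \<and>
     (\<exists>H S. subgroup H Cstar \<and> H \<subseteq> \<Gamma> \<and>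
        S \<subseteq> carrier Cstar \<and> finite S \<and> card S = s \<and> H = generate Cstar S \<and>
        (\<forall>x\<in>\<Gamma>. \<exists>k::nat. k \<ge> 1 \<and> x [^]\<^bsub>Cstar\<^esub> k \<in> H))"

definition rank_at_most :: "complex set \<Rightarrow> nat \<Rightarrow> bool" where
  "rank_at_most \<Gamma> t \<longleftrightarrow> (\<exists>s\<le>t. has_rank \<Gamma> s)"

text \<open>\<open>enumerate\<close> counts from 0, whereas \<open>prime1mod4 1 = 5\<close> is the first prime of the sequence.\<close>

definition prime1mod4 :: "nat \<Rightarrow> nat" where
  "prime1mod4 j = enumerate {p. prime p \<and> p mod 4 = 1} (j - 1)"

definition prime_product :: "nat \<Rightarrow> nat" where
  "prime_product r = (\<Prod>j\<in>{1..r - 1}. prime1mod4 j)"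

text \<open>
  The maximum exists for every \<open>n \<ge> 4\<close>: \<open>r = 1\<close> (the empty product) is admissible, and the
  products grow without bound.
\<close>

definition erdos_r :: "nat \<Rightarrow> nat" where
  "erdos_r n = (GREATEST r. r \<ge> 1 \<and> real (prime_product r) \<le> real n / 4)"

definition erdos_m :: "nat \<Rightarrow> nat" where
  "erdos_m n = prime_product (erdos_r n)"

definition erdos_grid :: "nat \<Rightarrow> complex set" where
  "erdos_grid n =
     {(of_int a + \<i> * of_int b) / complex_of_real (sqrt (real (erdos_m n))) | a b :: int.
        0 \<le> a \<and> real_of_int a < sqrt (real n) \<and> 0 \<le> b \<and> real_of_int b < sqrt (real n)}"

end

theory Submission
  imports
    Defs
    "HOL-Number_Theory.Number_Theory"
    "HOL-Library.Discrete_Functions"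
    "HOL-Real_Asymp.Real_Asymp"
begin

text \<open>
  Unit differences in the grid are \<open>z / \<surd>m\<close> for Gaussian integers \<open>z\<close> of norm \<open>m\<close>. Write
  \<open>p\<^sub>j = \<pi>\<^sub>j \<pi>\<^sub>j'\<close> with \<open>\<pi>\<^sub>j'\<close> the conjugate of \<open>\<pi>\<^sub>j\<close>. One of \<open>\<pi>\<^sub>j\<close>, \<open>\<pi>\<^sub>j'\<close> divides \<open>z\<close>, and
  \<open>\<alpha>\<^sub>j = \<pi>\<^sub>j / \<surd>p\<^sub>j\<close> satisfies \<open>\<pi>\<^sub>j' / \<surd>p\<^sub>j = 1 / \<alpha>\<^sub>j\<close>, so \<open>z / \<surd>m\<close> is a fourth root of unity times
  a product of the \<open>\<alpha>\<^sub>j\<close> and their inverses. Hence \<open>\<Gamma>\<close> can be taken to consist of all \<open>x\<close> such that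
  \<open>x ^ 4\<close> lies in the group generated by the \<open>\<alpha>\<^sub>j\<close>; passing to fourth powers absorbs the roots
  of unity at no cost in rank.

  For the size of \<open>r\<close>, \<open>p\<^sub>j > 4 j\<close> gives \<open>(r - 1) ln r \<le> ln m \<le> ln n\<close>, which is incompatible
  with \<open>r > 16 ln n / ln (ln n)\<close>.
\<close>

section \<open>Primes congruent to 1 modulo 4\<close>

text \<open>If \<open>q mod 4 = 3\<close>, raising \<open>x^2 = -1\<close> modulo \<open>q\<close>
  to the odd power \<open>(q - 1) div 2\<close> gives \<open>x^(q - 1) = -1\<close>, against
  Fermat's little theorem.\<close>

lemma prime_dvd_square_plus_one_mod_4:
  fixes q x :: nat
  assumes "prime q" "q \<noteq> 2" "q dvd x\<^sup>2 + 1"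
  shows "q mod 4 = 1"
proof (rule ccontr)
  assume neq: "q mod 4 \<noteq> 1"
  have "odd q"
    using assms primes_dvd_imp_eq two_is_prime_nat by blast
  then have "q mod 4 = 3"
    using neq by presburger
  then have odd: "odd ((q - 1) div 2)" and half: "q - 1 = 2 * ((q - 1) div 2)"
    by presburger+
  have "\<not> q dvd x"
  proof
    assume "q dvd x"
    then have "q dvd x\<^sup>2"
      by (simp add: power2_eq_square)
    then have "q dvd 1"
      using assms(3) dvd_add_right_iff by blast
    then show False
      using assms(1) not_prime_unit by blast
  qed
  then have "[x ^ (q - 1) = 1] (mod q)"
    by (rule fermat_theorem[OF assms(1)])
  then have one: "[int x ^ (q - 1) = 1] (mod int q)"
    by (metis cong_int_iff of_nat_1 of_nat_power)
  have "int q dvd int x ^ 2 + 1"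
    using assms(3) by (metis int_dvd_int_iff of_nat_1 of_nat_add of_nat_power)
  then have "[int x ^ 2 = - 1] (mod int q)"
    by (simp add: cong_iff_dvd_diff)
  then have "[(int x ^ 2) ^ ((q - 1) div 2) = (- 1) ^ ((q - 1) div 2)] (mod int q)"
    by (rule cong_pow)
  then have "[int x ^ (q - 1) = - 1] (mod int q)"
    using odd half by (metis power_mult power_minus_odd power_one)
  with one have "[1 = - 1] (mod int q)"
    using cong_sym cong_trans by blast
  then have "int q dvd 2"
    by (simp add: cong_iff_dvd_diff)
  then have "q dvd 2"
    by (metis int_dvd_int_iff of_nat_numeral)
  then show False
    using assms primes_dvd_imp_eq two_is_prime_nat by blast
qed

text \<open>Euclid's argument, applied to the square of a factorial plus one. The shift by 2
  excludes the prime 2 even for \<open>N = 0\<close>.\<close>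

lemma infinite_primes_1_mod_4: "infinite {p::nat. prime p \<and> p mod 4 = 1}"
  unfolding infinite_nat_iff_unbounded
proof
  fix N :: nat
  let ?x = "fact (N + 2) :: nat"
  have "?x\<^sup>2 + 1 \<noteq> 1"
    by simp
  then obtain q where q: "prime q" "q dvd ?x\<^sup>2 + 1"
    using prime_factor_nat by blast
  have "N + 2 < q"
  proof (rule ccontr)
    assume "\<not> N + 2 < q"
    then have "q dvd ?x"
      using prime_dvd_fact_iff[OF q(1), of "N + 2"] by linarith
    then have "q dvd ?x\<^sup>2"
      by (simp add: power2_eq_square)
    then have "q dvd 1"
      using q(2) dvd_add_right_iff by blast
    then show False
      using q(1) not_prime_unit by blast
  qed
  then show "\<exists>q>N. q \<in> {p. prime p \<and> p mod 4 = 1}"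
    using q prime_dvd_square_plus_one_mod_4[OF q(1) _ q(2)]
    by (intro exI[of _ q]) auto
qed

section \<open>Sums of two squares and division of Gaussian integers\<close>

lemma minus_one_square_mod_prime:
  fixes p :: nat
  assumes "prime p" "p mod 4 = 1"
  obtains x :: int where "int p dvd x\<^sup>2 + 1"
proof -
  have "p \<noteq> 2" "p > 1" "even ((p - 1) div 2)"
    using assms prime_gt_1_nat by (auto, presburger)
  then have "p > 2" by linarith
  have "[Legendre (- 1) p = (- 1) ^ ((p - 1) div 2)] (mod int p)"
    using euler_criterion[OF assms(1) \<open>p > 2\<close>] .
  then have "[Legendre (- 1) p = 1] (mod int p)"
    using \<open>even _\<close> by simp
  \<comment> \<open>The Legendre symbol is -1, 0 or 1; modulo \<open>p > 2\<close> only the value 1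
    is congruent to 1.\<close>
  moreover have "\<not> [- 1 = 1] (mod int p)" "\<not> [0 = 1] (mod int p)"
    using \<open>p > 2\<close> by (auto simp: cong_iff_dvd_diff dest!: zdvd_imp_le)
  ultimately have "QuadRes p (- 1)"
    unfolding Legendre_def by (auto split: if_splits)
  then show thesis
    using that unfolding QuadRes_def cong_iff_dvd_diff by auto
qed

text \<open>Thue's argument: among the more than \<open>p\<close> pairs \<open>(u, v)\<close> with \<open>0 \<le> u, v \<le> \<surd>p\<close>,
  two have the same residue \<open>u - x v\<close> modulo \<open>p\<close>, where \<open>x\<^sup>2 \<equiv> -1\<close>.\<close>

lemma prime_1_mod_4_sum_two_squares:
  fixes p :: nat
  assumes "prime p" "p mod 4 = 1"
  obtains c d :: int where "int p = c\<^sup>2 + d\<^sup>2"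
proof -
  obtain x :: int where x: "int p dvd x\<^sup>2 + 1"
    using minus_one_square_mod_prime[OF assms] .
  have p0: "p > 0"
    using assms(1) prime_gt_0_nat by blast
  define k where "k = floor_sqrt p"
  \<comment> \<open>Strictness of \<open>k^2 < p\<close> is what later gives
    \<open>a^2 + b^2 < 2 p\<close>, leaving \<open>p\<close> as the only positive multiple.\<close>
  have "k\<^sup>2 \<noteq> p"
    using assms(1) by (auto simp: prime_power_iff)
  then have k_less: "k\<^sup>2 < p"
    unfolding k_def using floor_sqrt_power2_le le_neq_implies_less by blast
  have k_greater: "p < (Suc k)\<^sup>2"
    unfolding k_def by (rule Suc_floor_sqrt_power2_gt)
  let ?A = "{0..int k} \<times> {0..int k}"
  let ?f = "\<lambda>(u, v). (u - x * v) mod int p"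
  have "?f ` ?A \<subseteq> {0..<int p}"
    using p0 by auto
  then have "card (?f ` ?A) \<le> p"
    using card_mono[of "{0..<int p}" "?f ` ?A"] by simp
  moreover have "card ?A = (Suc k)\<^sup>2"
    by (simp add: card_cartesian_product power2_eq_square nat_add_distrib)
  ultimately have "card (?f ` ?A) < card ?A"
    using k_greater by linarith
  then have "\<not> inj_on ?f ?A"
    by (rule pigeonhole)
  then obtain u v u' v' where uv: "(u, v) \<in> ?A" "(u', v') \<in> ?A" "(u, v) \<noteq> (u', v')"
    and eq: "(u - x * v) mod int p = (u' - x * v') mod int p"
    unfolding inj_on_def by auto
  define a b where "a = u - u'" and "b = v - v'"
  have "int p dvd (u - x * v) - (u' - x * v')"
    using eq by (simp add: mod_eq_dvd_iff)
  then have "int p dvd a - x * b"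
    by (simp add: a_def b_def algebra_simps)
  then have "int p dvd (a - x * b) * (a + x * b) + (x\<^sup>2 + 1) * b\<^sup>2"
    using x by simp
  also have "(a - x * b) * (a + x * b) + (x\<^sup>2 + 1) * b\<^sup>2 = a\<^sup>2 + b\<^sup>2"
    by (simp add: algebra_simps power2_eq_square)
  finally obtain t where t: "a\<^sup>2 + b\<^sup>2 = int p * t"
    by (elim dvdE)
  have "\<bar>a\<bar> \<le> \<bar>int k\<bar>" "\<bar>b\<bar> \<le> \<bar>int k\<bar>"
    using uv by (auto simp: a_def b_def)
  then have "a\<^sup>2 \<le> (int k)\<^sup>2" "b\<^sup>2 \<le> (int k)\<^sup>2"
    unfolding abs_le_square_iff .
  moreover have "(int k)\<^sup>2 < int p"
    using k_less by (metis of_nat_less_iff of_nat_power)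
  ultimately have "int p * t < int p * 2"
    using t by linarith
  then have "t < 2"
    using p0 by simp
  have "a \<noteq> 0 \<or> b \<noteq> 0"
    using uv(3) by (auto simp: a_def b_def)
  then have "a\<^sup>2 + b\<^sup>2 > 0"
    by (simp add: sum_power2_gt_zero_iff)
  then have "t > 0"
    unfolding t using p0 by (simp add: zero_less_mult_iff)
  with \<open>t < 2\<close> have "t = 1" by simp
  with t have "int p = a\<^sup>2 + b\<^sup>2" by simp
  then show thesis by (rule that)
qed

text \<open>This is \<open>a + i b = (c + i s d) (e + i f)\<close> in real coordinates: one of the
  two conjugate factors \<open>c + i d\<close>, \<open>c - i d\<close> of \<open>p\<close> divides
  \<open>a + i b\<close>, and the sign \<open>s\<close> records which.\<close>

lemma gaussian_division_by_prime:
  fixes a b c d :: int and p :: nat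
  assumes "prime p" "int p = c\<^sup>2 + d\<^sup>2" "a\<^sup>2 + b\<^sup>2 = int p * N"
  obtains e f s :: int where "\<bar>s\<bar> = 1" "e\<^sup>2 + f\<^sup>2 = N"
    "a = c * e - s * d * f" "b = c * f + s * d * e"
proof -
  have p0: "int p \<noteq> 0"
    using assms(1) not_prime_0 by (metis of_nat_eq_0_iff)
  have prime: "prime (int p)"
    using assms(1) by simp
  \<comment> \<open>The two factors on the right are the real parts of \<open>a + i b\<close> times
    \<open>c - i d\<close> and times \<open>c + i d\<close>; the one divisible by \<open>p\<close>
    determines \<open>s\<close>.\<close>
  have "c\<^sup>2 * (a\<^sup>2 + b\<^sup>2) - b\<^sup>2 * (c\<^sup>2 + d\<^sup>2) = (a * c + b * d) * (a * c - b * d)"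
    by (simp add: algebra_simps power2_eq_square)
  then have "(a * c + b * d) * (a * c - b * d) = int p * (c\<^sup>2 * N - b\<^sup>2)"
    using assms(2,3) by (simp add: algebra_simps)
  then have "int p dvd (a * c + b * d) * (a * c - b * d)"
    by simp
  then have "int p dvd a * c + b * d \<or> int p dvd a * c - b * d"
    using prime prime_dvd_mult_iff by blast
  then obtain s where s: "\<bar>s\<bar> = 1" and "int p dvd a * c + s * (b * d)"
    by (metis abs_1 abs_minus mult_1 mult_minus1 uminus_add_conv_diff add.commute)
  then obtain e where e: "a * c + s * (b * d) = int p * e"
    by (elim dvdE)
  have ss: "s * s = 1"
    using s by (metis abs_mult_self_eq mult_1)
  \<comment> \<open>Multiplicativity of the norm. Since the real part is a multiple of
    \<open>p\<close> and the total is \<open>p^2 * N\<close>, the imaginary part is a multiple of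
    \<open>p\<close> too.\<close>
  have norm: "(a * c + s * (b * d))\<^sup>2 + (b * c - s * (a * d))\<^sup>2
      = (a\<^sup>2 + b\<^sup>2) * (c\<^sup>2 + d\<^sup>2)"
  proof -
    have "(a * c + s * (b * d))\<^sup>2 + (b * c - s * (a * d))\<^sup>2
        = (a\<^sup>2 + b\<^sup>2) * c\<^sup>2 + (s * s) * ((a\<^sup>2 + b\<^sup>2) * d\<^sup>2)"
      by (simp add: algebra_simps power2_eq_square)
    then show ?thesis
      by (simp add: ss algebra_simps)
  qed
  then have pN: "(int p * e)\<^sup>2 + (b * c - s * (a * d))\<^sup>2 = int p * N * int p"
    unfolding e assms(2) [symmetric] assms(3) .
  then have "(b * c - s * (a * d))\<^sup>2 = int p * (int p * (N - e\<^sup>2))"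
    by (simp add: algebra_simps power2_eq_square)
  then have "int p dvd (b * c - s * (a * d))\<^sup>2"
    by simp
  then have "int p dvd b * c - s * (a * d)"
    using prime prime_dvd_power by blast
  then obtain f where f: "b * c - s * (a * d) = int p * f"
    by (elim dvdE)
  have "int p * a = int p * (c * e - s * d * f)"
  proof -
    have "int p * (c * e - s * d * f) = c * (int p * e) - s * d * (int p * f)"
      by (simp add: algebra_simps)
    also have "\<dots> = a * c\<^sup>2 + (s * s) * (a * d\<^sup>2)"
      unfolding e [symmetric] f [symmetric] by (simp add: algebra_simps power2_eq_square)
    finally show ?thesis
      by (simp add: ss assms(2) algebra_simps)
  qed
  moreover have "int p * b = int p * (c * f + s * d * e)"
  proof -
    have "int p * (c * f + s * d * e) = c * (int p * f) + s * d * (int p * e)"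
      by (simp add: algebra_simps)
    also have "\<dots> = b * c\<^sup>2 + (s * s) * (b * d\<^sup>2)"
      unfolding e [symmetric] f [symmetric] by (simp add: algebra_simps power2_eq_square)
    finally show ?thesis
      by (simp add: ss assms(2) algebra_simps)
  qed
  moreover have "int p * (int p * (e\<^sup>2 + f\<^sup>2)) = int p * (int p * N)"
    using pN unfolding f by (simp add: algebra_simps power2_eq_square)
  ultimately show thesis
    using p0 s by (intro that[of s e f]) auto
qed

section \<open>Growth of the prime products and the bound on \<open>r\<close>\<close>

lemma prime1mod4_in: "prime (prime1mod4 j)" "prime1mod4 j mod 4 = 1"
  using enumerate_in_set[OF infinite_primes_1_mod_4, of "j - 1"]
  by (simp_all add: prime1mod4_def)

lemma prime1mod4_Suc: "4 * Suc k < prime1mod4 (Suc k)"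
proof (induction k)
  case 0
  have "prime1mod4 1 > 1" "prime1mod4 1 mod 4 = 1"
    using prime1mod4_in[of 1] prime_gt_1_nat by auto
  then have "prime1mod4 1 > 4" by presburger
  then show ?case by simp
next
  case (Suc k)
  have "prime1mod4 (Suc k) < prime1mod4 (Suc (Suc k))"
    using enumerate_step[OF infinite_primes_1_mod_4] by (simp add: prime1mod4_def)
  then have "prime1mod4 (Suc k) + 4 \<le> prime1mod4 (Suc (Suc k))"
    using prime1mod4_in(2)[of "Suc k"] prime1mod4_in(2)[of "Suc (Suc k)"] by presburger
  then show ?case
    using Suc by simp
qed

lemma prime_product_Suc_Suc:
  "prime_product (Suc (Suc k)) = prime_product (Suc k) * prime1mod4 (Suc k)"
  by (simp add: prime_product_def)

lemma prime_product_pos: "prime_product r > 0"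
  unfolding prime_product_def
  by (intro prod_pos) (simp add: prime1mod4_in prime_gt_0_nat)

text \<open>From \<open>k\<close> to \<open>k + 1\<close> the left side grows by at most
  \<open>1 + ln (k + 1)\<close>, while the right side grows by
  \<open>ln (prime1mod4 (k + 1))\<close>, which is at least \<open>ln 4 + ln (k + 1)\<close>. The
  factor 4 in \<open>prime1mod4_Suc\<close> pays for the 1.\<close>

lemma ln_prime_product_ge:
  "real k * ln (real k + 1) \<le> ln (real (prime_product (Suc k)))"
proof (induction k)
  case 0
  then show ?case by (simp add: prime_product_def)
next
  case (Suc k)
  have "ln (real k + 2) - ln (real k + 1) = ln (1 + 1 / (real k + 1))"
    by (subst ln_divide_pos [symmetric]) (auto simp: field_simps)
  also have "\<dots> \<le> 1 / (real k + 1)"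
    by (rule ln_add_one_self_le_self) simp
  finally have "(real k + 1) * (ln (real k + 2) - ln (real k + 1)) \<le> 1"
    by (simp add: field_simps)
  also have "1 \<le> ln (4 :: real)"
    using exp_le by (subst ln_ge_iff) auto
  finally have step: "(real k + 1) * ln (real k + 2)
      \<le> real k * ln (real k + 1) + (ln 4 + ln (real k + 1))"
    by (simp add: algebra_simps)
  have "ln 4 + ln (real k + 1) = ln (4 * (real k + 1))"
    by (rule ln_mult_pos [symmetric]) auto
  also have "\<dots> \<le> ln (real (prime1mod4 (Suc k)))"
    using prime1mod4_Suc[of k] by (subst ln_le_cancel_iff) auto
  finally have "(real k + 1) * ln (real k + 2)
      \<le> ln (real (prime_product (Suc k))) + ln (real (prime1mod4 (Suc k)))"
    using step Suc by linarith
  also have "\<dots> = ln (real (prime_product (Suc (Suc k))))"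
    using prime_product_pos[of "Suc k"] prime1mod4_Suc[of k]
    by (simp add: prime_product_Suc_Suc ln_mult)
  finally show ?case by (simp add: algebra_simps)
qed

text \<open>Stated for every admissible \<open>r\<close>, so that it also shows that the maximum
  defining \<open>erdos_r\<close> exists.\<close>

lemma prime_product_index_bound:
  fixes n r :: nat
  assumes n: "ln (real n) > 1" and r: "r \<ge> 1" "real (prime_product r) \<le> real n / 4"
  shows "real r \<le> 16 * ln (real n) / ln (ln (real n))"
proof (rule ccontr)
  define L where "L = ln (real n)"
  define X where "X = 16 * L / ln L"
  assume "\<not> ?thesis"
  then have rX: "X < real r"
    by (simp add: X_def L_def)
  have L: "L > 1" "ln L > 0"
    using n by (auto simp: L_def)
  have "ln L \<le> L"
    using ln_le_minus_one[of L] L by linarith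
  then have "X \<ge> 16"
    using L by (simp add: X_def field_simps)
  obtain k where k: "r = Suc k"
    using r(1) by (cases r) auto
  have "n > 0"
    using n by (cases n) auto
  have "real k * ln (real r) \<le> ln (real (prime_product r))"
    using ln_prime_product_ge[of k] by (simp add: k add.commute)
  also have "\<dots> \<le> L"
    using r(2) prime_product_pos[of r] unfolding L_def
    by (subst ln_le_cancel_iff) (use \<open>n > 0\<close> in auto)
  finally have kL: "real k * ln (real r) \<le> L" .
  \<comment> \<open>Since \<open>X >= 16\<close>, replacing \<open>r\<close> by
    \<open>k = r - 1\<close> costs less than half of \<open>X\<close>.\<close>
  have "X / 2 < real k"
    using rX \<open>X \<ge> 16\<close> k by auto
  moreover have "ln X < ln (real r)" "ln X > 0"
    using rX \<open>X \<ge> 16\<close> by auto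
  ultimately have "X / 2 * ln X \<le> real k * ln (real r)"
    using \<open>X \<ge> 16\<close> by (intro mult_mono) auto
  with kL have le: "X / 2 * ln X \<le> L"
    by linarith
  \<comment> \<open>Aim: \<open>X >= sqrt L\<close>, hence \<open>ln X >= ln L / 2\<close>. Then
    \<open>X / 2 * ln X\<close> is at least \<open>4 * L\<close>, contradicting
    \<open>le\<close>.\<close>
  have "ln L = 2 * ln (sqrt L)"
    using L by (simp add: ln_sqrt)
  also have "\<dots> \<le> 16 * sqrt L"
    using ln_le_minus_one[of "sqrt L"] real_sqrt_gt_zero[of L] L by linarith
  finally have "sqrt L * ln L \<le> sqrt L * (16 * sqrt L)"
    using L by (intro mult_left_mono) auto
  also have "\<dots> = 16 * L"
    using L by simp
  finally have "sqrt L \<le> X"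
    using L by (simp add: X_def field_simps)
  then have "ln (sqrt L) \<le> ln X"
    using L \<open>X \<ge> 16\<close> by (subst ln_le_cancel_iff) auto
  then have "ln L / 2 \<le> ln X"
    using L by (simp add: ln_sqrt)
  then have "X / 2 * (ln L / 2) \<le> X / 2 * ln X"
    using \<open>X \<ge> 16\<close> by (intro mult_left_mono) auto
  also have "X / 2 * (ln L / 2) = 4 * L"
    using L by (simp add: X_def)
  finally show False
    using le L by linarith
qed

text \<open>\<open>GREATEST\<close> is meaningful only for a nonempty bounded set:
  \<open>r = 1\<close> is a member because \<open>n >= 4\<close>, and the index bound is an upper
  bound.\<close>

lemma erdos_r_admissible:
  assumes "ln (real n) > 1" "n \<ge> 4"
  shows "erdos_r n \<ge> 1" "real (prime_product (erdos_r n)) \<le> real n / 4"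
proof -
  let ?P = "\<lambda>r. r \<ge> 1 \<and> real (prime_product r) \<le> real n / 4"
  have "?P (erdos_r n)"
    unfolding erdos_r_def
  proof (rule GreatestI_nat)
    show "?P 1"
      using assms(2) by (simp add: prime_product_def)
    show "r \<le> nat \<lfloor>16 * ln (real n) / ln (ln (real n))\<rfloor>" if "?P r" for r
      using prime_product_index_bound[OF assms(1), of r] that by (simp add: le_nat_floor)
  qed
  then show "erdos_r n \<ge> 1" "real (prime_product (erdos_r n)) \<le> real n / 4"
    by auto
qed

section \<open>The multiplicative group of the complex numbers and its rank\<close>

lemma comm_group_Cstar: "comm_group Cstar"
  by (rule comm_groupI) (auto simp: Cstar_def intro!: bexI[of _ "inverse _"])

interpretation Cstar: comm_group Cstar
  by (rule comm_group_Cstar)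

lemma Cstar_simps [simp]:
  "carrier Cstar = - {0}" "x \<otimes>\<^bsub>Cstar\<^esub> y = x * y" "\<one>\<^bsub>Cstar\<^esub> = 1"
  by (simp_all add: Cstar_def)

lemma Cstar_pow [simp]: "x [^]\<^bsub>Cstar\<^esub> (k::nat) = x ^ k"
  by (induction k) (simp_all add: nat_pow_def Cstar_def mult.commute)

lemma Cstar_inv [simp]: "x \<noteq> 0 \<Longrightarrow> inv\<^bsub>Cstar\<^esub> x = inverse x"
  by (rule Cstar.inv_equality) auto

lemma (in group) subgroup_nat_pow_closed:
  assumes "subgroup H G" "h \<in> H"
  shows "h [^] (k::nat) \<in> H"
  using subgroup_int_pow_closed[OF assms, of "int k"] by (simp add: int_pow_int)

lemma subgroup_roots:
  assumes "subgroup H Cstar"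
  shows "subgroup {x. x \<noteq> 0 \<and> x ^ k \<in> H} Cstar"
proof (rule Cstar.subgroupI)
  have "1 \<in> H"
    using subgroup.one_closed[OF assms] by simp
  then show "{x. x \<noteq> 0 \<and> x ^ k \<in> H} \<noteq> {}"
    by (auto intro!: exI[of _ 1])
next
  fix x assume x: "x \<in> {x. x \<noteq> 0 \<and> x ^ k \<in> H}"
  then have "inverse (x ^ k) \<in> H"
    using subgroup.m_inv_closed[OF assms, of "x ^ k"] by simp
  then show "inv\<^bsub>Cstar\<^esub> x \<in> {x. x \<noteq> 0 \<and> x ^ k \<in> H}"
    using x by (simp add: power_inverse)
next
  fix x y assume "x \<in> {x. x \<noteq> 0 \<and> x ^ k \<in> H}" "y \<in> {x. x \<noteq> 0 \<and> x ^ k \<in> H}"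
  then show "x \<otimes>\<^bsub>Cstar\<^esub> y \<in> {x. x \<noteq> 0 \<and> x ^ k \<in> H}"
    using subgroup.m_closed[OF assms, of "x ^ k" "y ^ k"] by (simp add: power_mult_distrib)
qed auto

text \<open>The single exponent \<open>k\<close> serves as the power required by
  \<open>has_rank\<close> for every element. Closure of the generated group under powers places it
  inside the group of roots.\<close>

lemma rank_at_most_roots:
  assumes S: "finite S" "S \<subseteq> - {0}" "card S \<le> t" and "k \<ge> 1"
  shows "rank_at_most {x. x \<noteq> 0 \<and> x ^ k \<in> generate Cstar S} t"
    (is "rank_at_most ?G t")
proof -
  let ?H = "generate Cstar S"
  have H: "subgroup ?H Cstar"
    using S by (intro Cstar.generate_is_subgroup) simp
  have "x ^ k \<in> ?H" if "x \<in> ?H" for x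
    using Cstar.subgroup_nat_pow_closed[OF H that, of k] by simp
  moreover have "?H \<subseteq> - {0}"
    using subgroup.subset[OF H] by simp
  ultimately have "?H \<subseteq> ?G"
    by auto
  moreover have "\<forall>x\<in>?G. \<exists>k::nat. k \<ge> 1 \<and> x [^]\<^bsub>Cstar\<^esub> k \<in> ?H"
    using \<open>k \<ge> 1\<close> by auto
  ultimately have "has_rank ?G (card S)"
    unfolding has_rank_def using S H subgroup_roots[OF H, of k]
    by (intro conjI exI[of _ ?H] exI[of _ S]) simp_all
  then show ?thesis
    using S(3) unfolding rank_at_most_def by blast
qed

section \<open>Unit differences in the grid\<close>

text \<open>Induction on \<open>J\<close>, splitting off one prime at a time by
  \<open>gaussian_division_by_prime\<close>; the cofactor is a new Gaussian integer, so
  \<open>a\<close> and \<open>b\<close> must stay arbitrary.\<close>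

lemma normalized_gaussian_in_group:
  fixes p :: "'i \<Rightarrow> nat" and c d :: "'i \<Rightarrow> int" and a b :: int
  defines "\<alpha> \<equiv> \<lambda>j. Complex (of_int (c j)) (of_int (d j)) / complex_of_real (sqrt (real (p j)))"
  assumes G: "subgroup G Cstar" and roots: "\<And>z. z ^ 4 = 1 \<Longrightarrow> z \<in> G"
    and J: "finite J" "\<And>j. j \<in> J \<Longrightarrow> prime (p j)"
    "\<And>j. j \<in> J \<Longrightarrow> int (p j) = (c j)\<^sup>2 + (d j)\<^sup>2" "\<And>j. j \<in> J \<Longrightarrow> \<alpha> j \<in> G"
    and ab: "a\<^sup>2 + b\<^sup>2 = (\<Prod>j\<in>J. int (p j))"
  shows "Complex (of_int a) (of_int b) / complex_of_real (sqrt (real (\<Prod>j\<in>J. p j))) \<in> G"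
  using J ab
proof (induction J arbitrary: a b rule: finite_induct)
  case empty
  have ab1: "a\<^sup>2 + b\<^sup>2 = 1"
    using empty.prems(4) by simp
  \<comment> \<open>Norm 1 leaves only the units 1, -1, i, -i, all of them fourth roots of
    unity.\<close>
  have "(Complex (of_int a) (of_int b))\<^sup>2 = 1 \<or> (Complex (of_int a) (of_int b))\<^sup>2 = - 1"
  proof (cases "a = 0")
    case True
    then show ?thesis
      using ab1 by (auto simp: complex_eq_iff power2_eq_square simp flip: of_int_mult)
  next
    case False
    then have "a\<^sup>2 \<ge> 1"
      by (metis add_le_same_cancel2 int_one_le_iff_zero_less zero_less_power2)
    with ab1 have "b\<^sup>2 \<le> 0"
      by linarith
    then have "b = 0"
      by (metis power2_less_eq_zero_iff)
    then show ?thesis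
      using ab1 by (auto simp: complex_eq_iff power2_eq_square simp flip: of_int_mult)
  qed
  then have "(Complex (of_int a) (of_int b))\<^sup>2 * (Complex (of_int a) (of_int b))\<^sup>2 = 1"
    by (elim disjE) simp_all
  then have "Complex (of_int a) (of_int b) ^ 4 = 1"
    by (simp add: power4_eq_xxxx power2_eq_square mult.assoc)
  then show ?case
    using roots by simp
next
  case (insert j J)
  have prod: "(\<Prod>i\<in>insert j J. p i) = p j * (\<Prod>i\<in>J. p i)"
    using insert.hyps by simp
  have norm: "a\<^sup>2 + b\<^sup>2 = int (p j) * (\<Prod>i\<in>J. int (p i))"
    using insert.prems(4) insert.hyps by simp
  have "prime (p j)" and cd: "int (p j) = (c j)\<^sup>2 + (d j)\<^sup>2"
    using insert.prems by auto
  obtain e f s where s: "\<bar>s\<bar> = 1" and ef: "e\<^sup>2 + f\<^sup>2 = (\<Prod>i\<in>J. int (p i))"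
    and a: "a = c j * e - s * d j * f" and b: "b = c j * f + s * d j * e"
    using gaussian_division_by_prime[OF \<open>prime (p j)\<close> cd norm] .
  define w where "w = Complex (of_int e) (of_int f) / complex_of_real (sqrt (real (\<Prod>i\<in>J. p i)))"
  have "w \<in> G"
    unfolding w_def using insert.IH insert.prems ef by simp
  \<comment> \<open>The normalized factor split off is \<alpha> \<open>j\<close> or its conjugate.
    As \<alpha> \<open>j\<close> lies on the unit circle, the conjugate equals the inverse and stays
    in \<open>G\<close>.\<close>
  define \<beta> where "\<beta> = Complex (of_int (c j)) (of_int (s * d j)) / complex_of_real (sqrt (real (p j)))"
  have "\<alpha> j \<in> G" and pj: "p j > 0"
    using insert.prems prime_gt_0_nat by auto
  have "\<beta> \<in> G"
  proof (cases "s = 1")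
    case True
    then show ?thesis
      using \<open>\<alpha> j \<in> G\<close> by (simp add: \<alpha>_def \<beta>_def)
  next
    case False
    then have "s = - 1"
      using s by linarith
    then have "\<beta> * \<alpha> j = Complex (of_int ((c j)\<^sup>2 + (d j)\<^sup>2)) 0
        / (complex_of_real (sqrt (real (p j))))\<^sup>2"
      by (simp add: \<alpha>_def \<beta>_def complex_mult power2_eq_square)
    also have "(complex_of_real (sqrt (real (p j))))\<^sup>2 = of_nat (p j)"
      by (metis of_nat_0_le_iff of_real_of_nat_eq of_real_power real_sqrt_pow2)
    also have "Complex (of_int ((c j)\<^sup>2 + (d j)\<^sup>2)) 0 = of_nat (p j)"
      unfolding cd [symmetric] by (simp add: complex_eq_iff)
    finally have one: "\<beta> * \<alpha> j = 1"
      using pj by simp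
    then have "\<alpha> j \<noteq> 0"
      by auto
    with one have "\<beta> = inverse (\<alpha> j)"
      by (simp add: field_simps)
    then show ?thesis
      using subgroup.m_inv_closed[OF G \<open>\<alpha> j \<in> G\<close>] \<open>\<alpha> j \<noteq> 0\<close> by simp
  qed
  have "Complex (of_int a) (of_int b) =
      Complex (of_int (c j)) (of_int (s * d j)) * Complex (of_int e) (of_int f)"
    by (simp add: a b complex_eq_iff)
  then have "Complex (of_int a) (of_int b) / complex_of_real (sqrt (real (\<Prod>i\<in>insert j J. p i)))
      = \<beta> * w"
    unfolding prod \<beta>_def w_def by (simp add: real_sqrt_mult)
  also have "\<beta> * w \<in> G"
    using subgroup.m_closed[OF G \<open>\<beta> \<in> G\<close> \<open>w \<in> G\<close>] by simp
  finally show ?case .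
qed

lemma erdos_grid_unit_differenceE:
  assumes "p \<in> erdos_grid n" "q \<in> erdos_grid n" "cmod (q - p) = 1"
  obtains a b :: int where "a\<^sup>2 + b\<^sup>2 = int (erdos_m n)"
    "q - p = Complex (of_int a) (of_int b) / complex_of_real (sqrt (real (erdos_m n)))"
proof -
  let ?s = "complex_of_real (sqrt (real (erdos_m n)))"
  obtain a1 b1 a2 b2 :: int where "p = (of_int a1 + \<i> * of_int b1) / ?s"
    "q = (of_int a2 + \<i> * of_int b2) / ?s"
    using assms(1,2) unfolding erdos_grid_def by blast
  then have diff: "q - p = Complex (of_int (a2 - a1)) (of_int (b2 - b1)) / ?s"
    by (simp add: Complex_eq diff_divide_distrib [symmetric] algebra_simps)
  have m: "erdos_m n > 0"
    unfolding erdos_m_def by (rule prime_product_pos)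
  have "(cmod (q - p))\<^sup>2 = (of_int (a2 - a1) ^ 2 + of_int (b2 - b1) ^ 2) / real (erdos_m n)"
    unfolding diff norm_divide by (simp add: power_divide cmod_power2)
  then have "real_of_int ((a2 - a1)\<^sup>2 + (b2 - b1)\<^sup>2) = real_of_int (int (erdos_m n))"
    using assms(3) m by (simp add: field_simps)
  then have "(a2 - a1)\<^sup>2 + (b2 - b1)\<^sup>2 = int (erdos_m n)"
    unfolding of_int_eq_iff .
  then show thesis
    using diff by (rule that)
qed

text \<open>By definition \<open>erdos_m n\<close> is the product over the same indices that label
  the generators, so the argument is uniform in \<open>n\<close>; only the numerical bounds call for
  large \<open>n\<close>.\<close>

lemma erdos_grid_group:
  "\<exists>\<Gamma>. subgroup \<Gamma> Cstar \<and> rank_at_most \<Gamma> (erdos_r n - 1) \<and>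
     (\<forall>p\<in>erdos_grid n. \<forall>q\<in>erdos_grid n. cmod (q - p) = 1 \<longrightarrow> q - p \<in> \<Gamma>)"
proof -
  let ?J = "{1..erdos_r n - 1}"
  have "\<exists>c d :: int. int (prime1mod4 j) = c\<^sup>2 + d\<^sup>2" for j
    using prime_1_mod_4_sum_two_squares[OF prime1mod4_in[of j]] by blast
  then obtain c d :: "nat \<Rightarrow> int"
    where cd: "int (prime1mod4 j) = (c j)\<^sup>2 + (d j)\<^sup>2" for j
    by metis
  define \<alpha> where "\<alpha> j =
    Complex (of_int (c j)) (of_int (d j)) / complex_of_real (sqrt (real (prime1mod4 j)))" for j
  have pos: "prime1mod4 j > 0" for j
    using prime1mod4_in(1) prime_gt_0_nat by blast
  have "\<not> (c j = 0 \<and> d j = 0)" for j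
    using cd[of j] pos[of j] by auto
  then have nz: "\<alpha> j \<noteq> 0" for j
    using pos[of j] by (simp add: \<alpha>_def complex_eq_iff)
  define S where "S = \<alpha> ` ?J"
  define \<Gamma> where "\<Gamma> = {x. x \<noteq> 0 \<and> x ^ 4 \<in> generate Cstar S}"
  \<comment> \<open>Each prime contributes one generator, its conjugate being covered by the
    inverse; hence the count \<open>erdos_r n - 1\<close>.\<close>
  have S: "finite S" "S \<subseteq> - {0}" "card S \<le> erdos_r n - 1"
    using nz card_image_le[of ?J \<alpha>] by (auto simp: S_def)
  have H: "subgroup (generate Cstar S) Cstar"
    using S by (intro Cstar.generate_is_subgroup) simp
  have \<Gamma>: "subgroup \<Gamma> Cstar"
    unfolding \<Gamma>_def by (rule subgroup_roots[OF H])
  have roots: "z \<in> \<Gamma>" if "z ^ 4 = 1" for z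
    using that subgroup.one_closed[OF H] by (auto simp: \<Gamma>_def)
  have gens: "\<alpha> j \<in> \<Gamma>" if "j \<in> ?J" for j
  proof -
    have "\<alpha> j \<in> generate Cstar S"
      using that by (intro generate.incl) (simp add: S_def)
    from Cstar.subgroup_nat_pow_closed[OF H this, of 4] show ?thesis
      using nz by (simp add: \<Gamma>_def)
  qed
  have m: "erdos_m n = (\<Prod>j\<in>?J. prime1mod4 j)"
    by (simp add: erdos_m_def prime_product_def)
  have "q - p \<in> \<Gamma>" if pq: "p \<in> erdos_grid n" "q \<in> erdos_grid n" "cmod (q - p) = 1" for p q
  proof -
    obtain a b where ab: "a\<^sup>2 + b\<^sup>2 = int (erdos_m n)"
      and diff: "q - p = Complex (of_int a) (of_int b) / complex_of_real (sqrt (real (erdos_m n)))"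
      using erdos_grid_unit_differenceE[OF pq] .
    show ?thesis
      unfolding diff m
      by (rule normalized_gaussian_in_group[OF \<Gamma> roots, of ?J prime1mod4 c d])
        (use gens ab m cd prime1mod4_in in \<open>auto simp: \<alpha>_def\<close>)
  qed
  moreover have "rank_at_most \<Gamma> (erdos_r n - 1)"
    unfolding \<Gamma>_def by (rule rank_at_most_roots[OF S]) simp
  ultimately show ?thesis
    using \<Gamma> by blast
qed

theorem mainTheorem2:
  fixes c :: real
  assumes "c > 0"
  shows "\<exists>n0::nat. \<forall>n\<ge>n0. is_square n \<longrightarrow>
    (\<exists>\<Gamma>. subgroup \<Gamma> Cstar \<and> rank_at_most \<Gamma> (erdos_r n - 1) \<and>
       (\<forall>p\<in>erdos_grid n. \<forall>q\<in>erdos_grid n. cmod (q - p) = 1 \<longrightarrow> q - p \<in> \<Gamma>)) \<and>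
    real (erdos_r n) - 1 \<le> 16 * ln (real n) / ln (ln (real n)) - 1 \<and>
    16 * ln (real n) / ln (ln (real n)) - 1 \<le> c * ln (real n)"
proof -
  \<comment> \<open>After division by \<open>ln n\<close> the leading term is
    \<open>16 / ln (ln n)\<close>, which tends to 0 and so drops below \<open>c\<close>.\<close>
  have "eventually (\<lambda>n::nat. 16 * ln (real n) / ln (ln (real n)) - 1 \<le> c * ln (real n)) at_top"
    using assms by real_asymp
  moreover have "eventually (\<lambda>n::nat. ln (real n) > 1) at_top"
    by real_asymp
  ultimately have "eventually (\<lambda>n::nat. n \<ge> 4 \<and> ln (real n) > 1 \<and>
      16 * ln (real n) / ln (ln (real n)) - 1 \<le> c * ln (real n)) at_top"
    using eventually_ge_at_top[of 4] by eventually_elim auto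
  then obtain n0 :: nat where n0: "\<And>n. n \<ge> n0 \<Longrightarrow> n \<ge> 4 \<and> ln (real n) > 1 \<and>
      16 * ln (real n) / ln (ln (real n)) - 1 \<le> c * ln (real n)"
    unfolding eventually_at_top_linorder by blast
  have "real (erdos_r n) - 1 \<le> 16 * ln (real n) / ln (ln (real n)) - 1" if "n \<ge> n0" for n
    using n0[OF that] prime_product_index_bound[of n "erdos_r n"] erdos_r_admissible[of n] by simp
  with n0 show ?thesis
    using erdos_grid_group by blast
qed

end
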